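(* Let $\mathcal H$ be a real Hilbert space and let $f:\mathcal H\to\mathbb R$ be a convex differentiable function with $\operatorname{argmin}_{\mathcal H} f\neq\emptyset$. Let $\alpha>0$, $\mu\ge 0$ and let $x:[t_0,+\infty[\to\mathcal H$ be a solution trajectory of $$\ddot x(t)+\alpha\dot x(t)+e^{\mu t}\nabla f(x(t))=0 .$$ If $\alpha\le\mu$, then, as $t\to+\infty$, $$f(x(t))-\min_{\mathcal H} f=\mathcal O\left(e^{-\frac{2\alpha+\mu}{3}t}\right).$$
   Context: Here $t_0\ge 0$. A solution trajectory is a $C^2$ function $x:[t_0,+\infty[\to\mathcal H$ satisfying the differential equation for all $t\ge t_0$ (existence is taken for granted). *)

theory Defs
  imports "HOL-Analysis.Analysis" "HOL-Library.Landau_Symbols"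
begin

definition gradient :: "('a::real_inner \<Rightarrow> real) \<Rightarrow> 'a \<Rightarrow> 'a" where
  "gradient f y = (THE g. GDERIV f y :> g)"

text \<open>Existence of the gradient of a differentiable function on a Hilbert space rests on the
  Riesz representation theorem.\<close>

lemma riesz_representation:
  fixes L :: "'a::{real_inner,complete_space} \<Rightarrow> real"
  assumes "bounded_linear L"
  shows "\<exists>g. \<forall>h. L h = h \<bullet> g"
proof -
  interpret L: bounded_linear L by fact
  define J where "J v = (norm v)\<^sup>2 - 2 * L v" for v
  obtain K where K: "\<And>v. norm (L v) \<le> norm v * K" using L.bounded by blast
  have lb: "- (K\<^sup>2) \<le> J v" for v
  proof -
    have "L v \<le> norm v * K" using K[of v] by simp
    moreover have "0 \<le> (norm v - K)\<^sup>2" by simp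
    ultimately show ?thesis unfolding J_def by (simp add: power2_diff)
  qed
  have bdd: "bdd_below (range J)" using lb by (auto intro!: bdd_belowI)
  define m where "m = Inf (range J)"
  have mJ: "m \<le> J v" for v unfolding m_def by (rule cInf_lower[OF _ bdd]) simp
  have "\<exists>v. J v < m + inverse (real (Suc n))" for n
  proof -
    have "Inf (range J) < m + inverse (real (Suc n))" by (simp add: m_def)
    then show ?thesis using cInf_lessD[of "range J"] by blast
  qed
  then obtain v where v: "\<And>n. J (v n) < m + inverse (real (Suc n))" by metis
  have par: "(norm (a - b))\<^sup>2 \<le> 2 * (J a - m) + 2 * (J b - m)" for a b
  proof -
    define c where "c = (1/2) *\<^sub>R (a + b)"
    have "(norm (a - b))\<^sup>2 = 2 * J a + 2 * J b - 4 * J c"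
      unfolding J_def c_def by (simp add: power2_norm_eq_inner L.add L.scaleR
          inner_add_left inner_add_right inner_diff_left inner_diff_right inner_commute field_simps
          del: norm_scaleR)
    with mJ[of c] show ?thesis by (simp add: algebra_simps)
  qed
  have "Cauchy v"
  proof (rule metric_CauchyI)
    fix e :: real assume "0 < e"
    then obtain N where N: "inverse (real (Suc N)) < e\<^sup>2 / 4"
      using reals_Archimedean[of "e\<^sup>2 / 4"] by auto
    have "dist (v i) (v j) < e" if "N \<le> i" "N \<le> j" for i j
    proof -
      have "inverse (real (Suc i)) \<le> inverse (real (Suc N))"
        "inverse (real (Suc j)) \<le> inverse (real (Suc N))"
        using that by (simp_all add: le_imp_inverse_le)
      with v[of i] v[of j] N have "J (v i) - m < e\<^sup>2 / 4" "J (v j) - m < e\<^sup>2 / 4"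
        by linarith+
      with par[of "v i" "v j"] have "(norm (v i - v j))\<^sup>2 < e\<^sup>2" by argo
      then show ?thesis
        using \<open>0 < e\<close> by (simp add: dist_norm power2_less_imp_less)
    qed
    then show "\<exists>M. \<forall>i\<ge>M. \<forall>j\<ge>M. dist (v i) (v j) < e" by blast
  qed
  then obtain g where g: "v \<longlonglongrightarrow> g" using Cauchy_convergent_iff convergent_def by blast
  have "(\<lambda>n. J (v n)) \<longlonglongrightarrow> J g" unfolding J_def
    by (intro tendsto_intros g L.tendsto)
  moreover have "(\<lambda>n. m + inverse (real (Suc n))) \<longlonglongrightarrow> m + 0"
    by (intro tendsto_intros LIMSEQ_inverse_real_of_nat)
  ultimately have "J g \<le> m + 0"
    by (rule LIMSEQ_le) (use v in \<open>auto intro: less_imp_le\<close>)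
  then have min: "J g \<le> J w" for w using mJ[of w] by linarith
  have "L h = h \<bullet> g" for h
  proof (cases "h = 0")
    case False
    define c where "c = h \<bullet> g - L h"
    define t where "t = - c / (h \<bullet> h)"
    have hh: "h \<bullet> h \<noteq> 0" using False by simp
    have "J (g + t *\<^sub>R h) = J g + 2 * t * c + t * (t * (h \<bullet> h))"
      unfolding J_def c_def
      by (simp add: power2_norm_eq_inner L.add L.scaleR
          inner_add_left inner_add_right inner_commute algebra_simps
          del: norm_scaleR)
    also have "t * (h \<bullet> h) = - c" using hh by (simp add: t_def)
    finally have "J (g + t *\<^sub>R h) = J g + t * c" by simp
    with min[of "g + t *\<^sub>R h"] have "0 \<le> t * c" by linarith
    then have "c\<^sup>2 / (h \<bullet> h) \<le> 0" by (simp add: t_def power2_eq_square)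
    moreover have "0 < h \<bullet> h" using False by simp
    ultimately have "c\<^sup>2 \<le> 0" by (simp only: divide_le_0_iff) auto
    then show ?thesis by (simp add: c_def)
  qed simp
  then show ?thesis by blast
qed

lemma gradient_GDERIV:
  fixes f :: "'a::{real_inner,complete_space} \<Rightarrow> real"
  assumes "f differentiable (at y)"
  shows "GDERIV f y :> gradient f y"
proof -
  obtain D where D: "(f has_derivative D) (at y)"
    using assms by (auto simp: differentiable_def)
  obtain g where "\<And>h. D h = h \<bullet> g"
    using riesz_representation[OF has_derivative_bounded_linear[OF D]] by blast
  then have "D = (\<lambda>h. h \<bullet> g)" by auto
  with D have g: "GDERIV f y :> g" by (simp add: gderiv_def)
  moreover have "g' = g" if "GDERIV f y :> g'" for g'
  proof -
    have "(\<lambda>h. h \<bullet> g') = (\<lambda>h. h \<bullet> g)"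
      using that g unfolding gderiv_def by (rule has_derivative_unique)
    then have "(g' - g) \<bullet> (g' - g) = 0"
      by (metis inner_diff_right right_minus_eq)
    then show ?thesis by simp
  qed
  ultimately show ?thesis unfolding gradient_def by (rule theI)
qed

text \<open>Only the values of \<open>x\<close> on \<open>{t0..}\<close> matter; derivatives at \<open>t0\<close> are one-sided.\<close>

definition solution_trajectory ::
  "('a::real_inner \<Rightarrow> real) \<Rightarrow> real \<Rightarrow> real \<Rightarrow> real \<Rightarrow> (real \<Rightarrow> 'a) \<Rightarrow> bool" where
  "solution_trajectory f \<alpha> \<mu> t0 x \<longleftrightarrow>
     (\<exists>x' x''.
        (\<forall>t\<ge>t0. (x has_vector_derivative x' t) (at t within {t0..})) \<and>
        (\<forall>t\<ge>t0. (x' has_vector_derivative x'' t) (at t within {t0..})) \<and>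
        continuous_on {t0..} x'' \<and>
        (\<forall>t\<ge>t0. x'' t + \<alpha> *\<^sub>R x' t + exp (\<mu> * t) *\<^sub>R gradient f (x t) = 0))"

end

theory Submission
  imports Defs
begin

text \<open>
  Fix a minimiser \<open>z\<close> of \<open>f\<close> and put \<open>l = (2 * \<alpha> + \<mu>) / 3\<close> and \<open>c = (\<alpha> - \<mu>) / 3\<close>, so that
  \<open>l + c = \<alpha>\<close> and \<open>\<mu> + 2 * c = l\<close>. Along a trajectory \<open>x\<close> with velocity \<open>v\<close> the energy
  \<open>E t = exp (2 * c * t) * (exp (\<mu> * t) * (f (x t) - f z)
           + (norm (l *\<^sub>R (x t - z) + v t))\<^sup>2 / 2 - l * c * (norm (x t - z))\<^sup>2 / 2)\<close>
  has derivative
  \<open>exp (2 * c * t) * (l * exp (\<mu> * t) * (f (x t) - f z - (x t - z) \<bullet> gradient f (x t))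
           + c * l * (l - c) * (norm (x t - z))\<^sup>2)\<close>.
  The two relations between \<open>l\<close> and \<open>c\<close> and the weight \<open>- l * c\<close> are what is needed to cancel the
  terms in \<open>(norm v)\<^sup>2\<close> and \<open>(x - z) \<bullet> v\<close>, and to match the coefficient of \<open>f (x t) - f z\<close> with
  that of the gradient term. Convexity and \<open>0 \<le> l\<close> make the first summand of the derivative nonpositive. The
  hypothesis \<open>\<alpha> \<le> \<mu>\<close> says \<open>c \<le> 0\<close>; together with \<open>0 \<le> l\<close> it makes the second summand nonpositive and, at the same time,
  makes every summand of \<open>E\<close> nonnegative. Hence \<open>E\<close> decreases and dominates its first summand
  \<open>exp (l * t) * (f (x t) - f z)\<close>, which is the claimed decay.
\<close>

text \<open>On the line through \<open>y\<close> and \<open>z\<close> this is the tangent inequality for convex functions of one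
  real variable.\<close>

lemma convex_on_imp_above_gradient:
  fixes f :: "'a::real_inner \<Rightarrow> real"
  assumes convex: "convex_on UNIV f" and deriv: "GDERIV f y :> g"
  shows "f y + (z - y) \<bullet> g \<le> f z"
proof -
  define \<phi> where "\<phi> s = f (y + s *\<^sub>R (z - y))" for s :: real
  have "convex_on UNIV \<phi>"
  proof (rule convex_onI)
    fix t a b :: real assume t: "0 < t" "t < 1"
    have "y + ((1 - t) *\<^sub>R a + t *\<^sub>R b) *\<^sub>R (z - y)
        = (1 - t) *\<^sub>R (y + a *\<^sub>R (z - y)) + t *\<^sub>R (y + b *\<^sub>R (z - y))"
      by (simp add: algebra_simps)
    then show "\<phi> ((1 - t) *\<^sub>R a + t *\<^sub>R b) \<le> (1 - t) * \<phi> a + t * \<phi> b"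
      using convex_onD[OF convex, of t] t unfolding \<phi>_def by simp
  qed simp
  moreover have "(\<phi> has_real_derivative (z - y) \<bullet> g) (at 0)"
  proof -
    have "((\<lambda>s::real. y + s *\<^sub>R (z - y)) has_derivative (\<lambda>s. s *\<^sub>R (z - y))) (at 0)"
      by (auto intro!: derivative_eq_intros)
    moreover have "(f has_derivative (\<lambda>h. h \<bullet> g)) (at (y + 0 *\<^sub>R (z - y)))"
      using deriv by (simp add: gderiv_def)
    ultimately have "(\<phi> has_derivative (\<lambda>s. (s *\<^sub>R (z - y)) \<bullet> g)) (at 0)"
      unfolding \<phi>_def by (rule has_derivative_compose)
    then show ?thesis
      by (simp add: has_field_derivative_def mult.commute[of _ "(z - y) \<bullet> g"])
  qed
  ultimately have "\<phi> 1 - \<phi> 0 \<ge> ((z - y) \<bullet> g) * (1 - 0)"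
    by (intro convex_on_imp_above_tangent[of UNIV]) auto
  then show ?thesis by (simp add: \<phi>_def)
qed

lemma has_real_derivative_compose_GDERIV:
  fixes f :: "'a::real_inner \<Rightarrow> real"
  assumes "GDERIV f (x t) :> g" and "(x has_vector_derivative v) (at t within S)"
  shows "((\<lambda>s. f (x s)) has_real_derivative v \<bullet> g) (at t within S)"
proof -
  have "((\<lambda>s. f (x s)) has_derivative (\<lambda>s. (s *\<^sub>R v) \<bullet> g)) (at t within S)"
    using assms unfolding gderiv_def has_vector_derivative_def
    by (intro has_derivative_compose[of x _ _ _ f])
  then show ?thesis
    by (simp add: has_field_derivative_def mult.commute[of _ "v \<bullet> g"])
qed

lemma has_real_derivative_inner:
  fixes u w :: "real \<Rightarrow> 'a::real_inner"
  assumes "(u has_vector_derivative u') (at t within S)"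
    and "(w has_vector_derivative w') (at t within S)"
  shows "((\<lambda>s. u s \<bullet> w s) has_real_derivative u t \<bullet> w' + u' \<bullet> w t) (at t within S)"
  using bounded_bilinear.has_vector_derivative[OF bounded_bilinear_inner assms]
  by (simp add: has_real_derivative_iff_has_vector_derivative)

text \<open>The energy of the introduction. Writing \<open>\<alpha>\<close> as \<open>l + c\<close> and \<open>\<mu>\<close> as \<open>l - 2 * c\<close> turns the
  cancellations into polynomial identities in \<open>l\<close> and \<open>c\<close>. Squared norms are written as inner
  products, to which the product rule applies directly.\<close>

definition energy ::
  "('a::real_inner \<Rightarrow> real) \<Rightarrow> 'a \<Rightarrow> real \<Rightarrow> real \<Rightarrow> (real \<Rightarrow> 'a) \<Rightarrow> (real \<Rightarrow> 'a) \<Rightarrow> real \<Rightarrow> real"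
  where "energy f z l c x v t =
    exp (2 * c * t) * (exp ((l - 2 * c) * t) * (f (x t) - f z)
      + (l *\<^sub>R (x t - z) + v t) \<bullet> (l *\<^sub>R (x t - z) + v t) / 2
      - l * c * ((x t - z) \<bullet> (x t - z)) / 2)"

lemma energy_has_real_derivative:
  fixes f :: "'a::real_inner \<Rightarrow> real"
  assumes f: "GDERIV f (x t) :> g"
    and x: "(x has_vector_derivative v t) (at t within S)"
    and v: "(v has_vector_derivative a) (at t within S)"
    and ode: "a + (l + c) *\<^sub>R v t + exp ((l - 2 * c) * t) *\<^sub>R g = 0"
  shows "(energy f z l c x v has_real_derivative
    exp (2 * c * t) * (l * exp ((l - 2 * c) * t) * (f (x t) - f z - (x t - z) \<bullet> g)
      + c * l * (l - c) * ((x t - z) \<bullet> (x t - z)))) (at t within S)"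
proof -
  define u where "u s = x s - z" for s
  define w where "w s = l *\<^sub>R u s + v s" for s
  define K where "K = exp ((l - 2 * c) * t)"
  have u: "(u has_vector_derivative v t) (at t within S)"
    unfolding u_def using x by (auto intro!: derivative_eq_intros)
  have w: "(w has_vector_derivative l *\<^sub>R v t + a) (at t within S)"
    unfolding w_def using u v by (auto intro!: derivative_eq_intros)
  have a: "a = - ((l + c) *\<^sub>R v t) - K *\<^sub>R g"
    using ode unfolding K_def[symmetric] by (metis add.assoc eq_neg_iff_add_eq_0 minus_add uminus_add_conv_diff add.commute)
  have fx: "((\<lambda>s. f (x s)) has_real_derivative v t \<bullet> g) (at t within S)"
    using f x by (rule has_real_derivative_compose_GDERIV)
  have uu: "((\<lambda>s. u s \<bullet> u s) has_real_derivative 2 * (u t \<bullet> v t)) (at t within S)"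
    using has_real_derivative_inner[OF u u] by (simp add: inner_commute)
  have ww: "((\<lambda>s. w s \<bullet> w s) has_real_derivative 2 * (w t \<bullet> (l *\<^sub>R v t + a))) (at t within S)"
    using has_real_derivative_inner[OF w w] by (simp add: inner_commute)
  have "((\<lambda>s. exp (2 * c * s) * (exp ((l - 2 * c) * s) * (f (x s) - f z)
        + w s \<bullet> w s / 2 - l * c * (u s \<bullet> u s) / 2)) has_real_derivative
      exp (2 * c * t) * (2 * c * (K * (f (x t) - f z) + w t \<bullet> w t / 2 - l * c * (u t \<bullet> u t) / 2)
        + ((l - 2 * c) * K * (f (x t) - f z) + K * (v t \<bullet> g)
          + w t \<bullet> (l *\<^sub>R v t + a) - l * c * (u t \<bullet> v t)))) (at t within S)"
    by (auto intro!: derivative_eq_intros fx uu ww simp: K_def algebra_simps add_divide_distrib)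
  moreover have "2 * c * (K * (f (x t) - f z) + w t \<bullet> w t / 2 - l * c * (u t \<bullet> u t) / 2)
        + ((l - 2 * c) * K * (f (x t) - f z) + K * (v t \<bullet> g)
          + w t \<bullet> (l *\<^sub>R v t + a) - l * c * (u t \<bullet> v t))
      = l * K * (f (x t) - f z - u t \<bullet> g) + c * l * (l - c) * (u t \<bullet> u t)"
    unfolding w_def a
    by (simp add: inner_add_left inner_add_right inner_diff_right inner_commute[of "v t" "u t"]
        field_simps)
  ultimately show ?thesis
    unfolding energy_def[abs_def] u_def w_def K_def by simp
qed

lemma energy_antimono:
  fixes f :: "'a::real_inner \<Rightarrow> real"
  assumes convex: "convex_on UNIV f" and f: "\<And>y. GDERIV f y :> g y"
    and x: "\<And>t. t \<ge> t0 \<Longrightarrow> (x has_vector_derivative v t) (at t within {t0..})"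
    and v: "\<And>t. t \<ge> t0 \<Longrightarrow> (v has_vector_derivative a t) (at t within {t0..})"
    and ode: "\<And>t. t \<ge> t0 \<Longrightarrow> a t + (l + c) *\<^sub>R v t + exp ((l - 2 * c) * t) *\<^sub>R g (x t) = 0"
    and "0 \<le> l" "c \<le> 0" "t0 \<le> t"
  shows "energy f z l c x v t \<le> energy f z l c x v t0"
proof (rule DERIV_nonpos_imp_decreasing_open[of t0 t "energy f z l c x v"])
  note deriv = energy_has_real_derivative[OF f x v ode]
  \<comment> \<open>The derivative at \<open>t0\<close> is one-sided: there only continuity is used, and two-sided
    derivatives are needed in the open interval alone.\<close>
  show "continuous_on {t0..t} (energy f z l c x v)"
    by (rule continuous_on_subset[of "{t0..}"], rule DERIV_continuous_on, rule deriv) auto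
  fix s assume s: "t0 < s" "s < t"
  have "f (x s) - f z - (x s - z) \<bullet> g (x s) \<le> 0"
    using convex_on_imp_above_gradient[OF convex f, of "x s" z] by (simp add: inner_diff_left)
  then have "l * exp ((l - 2 * c) * s) * (f (x s) - f z - (x s - z) \<bullet> g (x s)) \<le> 0"
    using \<open>0 \<le> l\<close> by (simp add: mult_nonneg_nonpos)
  moreover have "c * l * (l - c) * ((x s - z) \<bullet> (x s - z)) \<le> 0"
    using \<open>0 \<le> l\<close> \<open>c \<le> 0\<close> by (intro mult_nonpos_nonneg) auto
  ultimately have "exp (2 * c * s) * (l * exp ((l - 2 * c) * s) * (f (x s) - f z - (x s - z) \<bullet> g (x s))
      + c * l * (l - c) * ((x s - z) \<bullet> (x s - z))) \<le> 0"
    by (intro mult_nonneg_nonpos) auto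
  moreover have "at s within {t0..} = at s"
    using s by (intro at_within_interior) simp
  ultimately show "\<exists>y. DERIV (energy f z l c x v) s :> y \<and> y \<le> 0"
    using deriv[of s z] s by auto
qed fact

lemma gap_le_energy:
  assumes "0 \<le> l" "c \<le> 0"
  shows "exp (l * t) * (f (x t) - f z) \<le> energy f z l c x v t"
proof -
  have "exp (l * t) = exp (2 * c * t) * exp ((l - 2 * c) * t)"
    by (simp add: exp_add[symmetric] algebra_simps)
  moreover have "l * c * ((x t - z) \<bullet> (x t - z)) \<le> 0"
    using assms by (intro mult_nonpos_nonneg mult_nonneg_nonpos) auto
  moreover have "0 \<le> (l *\<^sub>R (x t - z) + v t) \<bullet> (l *\<^sub>R (x t - z) + v t)"
    by (rule inner_ge_zero)
  ultimately show ?thesis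
    unfolding energy_def by (simp add: mult.assoc del: inner_ge_zero)
qed

theorem corollary3:
  fixes f :: "'a::{real_inner,complete_space} \<Rightarrow> real"
    and x :: "real \<Rightarrow> 'a"
    and \<alpha> \<mu> t0 :: real
  assumes "convex_on UNIV f"
    and "\<forall>y. f differentiable (at y)"
    and "{z. is_arg_min f (\<lambda>_. True) z} \<noteq> {}"
    and "t0 \<ge> 0" and "\<alpha> > 0" and "\<mu> \<ge> 0"
    and "solution_trajectory f \<alpha> \<mu> t0 x"
    and "\<alpha> \<le> \<mu>"
  shows "(\<lambda>t. f (x t) - f (arg_min f (\<lambda>_. True)))
           \<in> O[at_top](\<lambda>t. exp (- ((2 * \<alpha> + \<mu>) / 3) * t))"
proof -
  define z where "z = arg_min f (\<lambda>_. True)"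
  define l where "l = (2 * \<alpha> + \<mu>) / 3"
  define c where "c = (\<alpha> - \<mu>) / 3"
  have "is_arg_min f (\<lambda>_. True) z"
    using assms(3) unfolding z_def arg_min_def by (auto intro: someI)
  then have z: "f z \<le> f y" for y by (simp add: is_arg_min_linorder)
  have lc: "0 \<le> l" "c \<le> 0" using assms by (auto simp: l_def c_def)
  have \<alpha>: "\<alpha> = l + c" and \<mu>: "\<mu> = l - 2 * c" by (simp_all add: l_def c_def field_simps)
  obtain v a where x: "\<And>t. t \<ge> t0 \<Longrightarrow> (x has_vector_derivative v t) (at t within {t0..})"
    and v: "\<And>t. t \<ge> t0 \<Longrightarrow> (v has_vector_derivative a t) (at t within {t0..})"
    and ode: "\<And>t. t \<ge> t0 \<Longrightarrow> a t + \<alpha> *\<^sub>R v t + exp (\<mu> * t) *\<^sub>R gradient f (x t) = 0"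
    using assms(7) unfolding solution_trajectory_def by blast
  have grad: "GDERIV f y :> gradient f y" for y
    using assms(2) by (simp add: gradient_GDERIV)
  define C where "C = energy f z l c x v t0"
  have "norm (f (x t) - f z) \<le> C * norm (exp (- l * t))" if "t \<ge> t0" for t
  proof -
    have "exp (l * t) * (f (x t) - f z) \<le> C"
      using gap_le_energy[OF lc, of t f x z v]
        energy_antimono[OF assms(1) grad x v ode[unfolded \<alpha> \<mu>] lc that, of z]
      unfolding C_def by linarith
    then show ?thesis
      using z[of "x t"] by (simp add: exp_minus field_simps)
  qed
  then have "(\<lambda>t. f (x t) - f z) \<in> O[at_top](\<lambda>t. exp (- l * t))"
    by (intro bigoI[of _ C] eventually_at_top_linorderI)
  then show ?thesis by (simp add: z_def l_def)
qed

end
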